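(* Let $D\subseteq\mathbb{R}^n$ be a non-empty closed convex set, let $f:D\to\mathbb{R}$ be a dc function, and let $f=g-h$ and $f=g'-h'$ be two dc decompositions of $f$ over $D$ (so $g,h,g',h':D\to\mathbb{R}$ are convex functions). Then: (i) The function $g$ is less (resp. more) convex than $g'$ if and only if $h$ is less (resp. more) convex than $h'$. (ii) If $g$ is less convex than $g'$, then for $x^k\in D$ the convex overestimations $f_g^k$ and $f_{g'}^k$ of $f$ given by $$f_g^k(x)=g(x)-\big(h(x^k)+\langle x-x^k,y^k\rangle\big),\quad\text{with } y^k\in\partial h(x^k),$$ $$f_{g'}^k(x)=g'(x)-\big(h'(x^k)+\langle x-x^k,y'^k\rangle\big),\quad\text{with } y'^k\in\partial h'(x^k),$$ satisfy $$f_g^k(x)\le f_{g'}^k(x),\quad\forall x\in D.$$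
   Context: A function $f:D\to\mathbb{R}$ is a dc function if it can be written as $f=g-h$ with $g,h:D\to\mathbb{R}$ convex; such a representation is called a dc decomposition of $f$. For two convex functions $g,g'$ on $D$, $g$ is said to be more (resp. less) convex than $g'$ if $g-g'$ (resp. $g'-g$) is a convex function on $D$. For a convex function $h:D\to\mathbb{R}$, $\partial h(x)$ denotes the subdifferential of $h$ at $x$ (in the sense of convex analysis), and $\langle\cdot,\cdot\rangle$ is the Euclidean inner product.
   Formalization: In (ii) the inequality fails for unrelated subgradients (e.g. g=h=g'=h'=norm at 0), so the choices are matched: each y'^k in ∂h'(x^k) has some y^k in ∂h(x^k), and each y^k has some y'^k when ∂h'(x^k) is non-empty, for which it holds on D. *)

theory Defs
  imports "HOL-Analysis.Analysis"
begin

text \<open>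
  A function \<open>D \<rightarrow> \<real>\<close> is a total function of which only the values on \<open>D\<close> matter.
  \<^const>\<open>convex_on\<close> \<open>D\<close> includes convexity of the set \<open>D\<close>.
\<close>

definition dc_decomposition ::
  "'a::real_vector set \<Rightarrow> ('a \<Rightarrow> real) \<Rightarrow> ('a \<Rightarrow> real) \<Rightarrow> ('a \<Rightarrow> real) \<Rightarrow> bool" where
  "dc_decomposition D f g h \<longleftrightarrow>
     convex_on D g \<and> convex_on D h \<and> (\<forall>x\<in>D. f x = g x - h x)"

definition dc_function :: "'a::real_vector set \<Rightarrow> ('a \<Rightarrow> real) \<Rightarrow> bool" where
  "dc_function D f \<longleftrightarrow> (\<exists>g h. dc_decomposition D f g h)"

definition more_convex_on ::
  "'a::real_vector set \<Rightarrow> ('a \<Rightarrow> real) \<Rightarrow> ('a \<Rightarrow> real) \<Rightarrow> bool" where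
  "more_convex_on D g g' \<longleftrightarrow> convex_on D (\<lambda>x. g x - g' x)"

definition less_convex_on ::
  "'a::real_vector set \<Rightarrow> ('a \<Rightarrow> real) \<Rightarrow> ('a \<Rightarrow> real) \<Rightarrow> bool" where
  "less_convex_on D g g' \<longleftrightarrow> convex_on D (\<lambda>x. g' x - g x)"

text \<open>
  The subgradient inequality is required on \<open>D\<close> only, that is, \<open>h\<close> is taken to be \<open>\<infinity>\<close>
  outside \<open>D\<close>. The set may be empty at relative boundary points of \<open>D\<close>.
\<close>

definition subdifferential ::
  "'a::real_inner set \<Rightarrow> ('a \<Rightarrow> real) \<Rightarrow> 'a \<Rightarrow> 'a set" where
  "subdifferential D h x = {y. x \<in> D \<and> (\<forall>z\<in>D. h z \<ge> h x + (z - x) \<bullet> y)}"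

text \<open>The function obtained from \<open>g - h\<close> by linearising \<open>h\<close> at \<open>xk\<close> with slope \<open>y\<close>.\<close>

definition dc_overestimation ::
  "('a::real_inner \<Rightarrow> real) \<Rightarrow> ('a \<Rightarrow> real) \<Rightarrow> 'a \<Rightarrow> 'a \<Rightarrow> 'a \<Rightarrow> real" where
  "dc_overestimation g h xk y x = g x - (h xk + (x - xk) \<bullet> y)"

lemma dc_overestimation_ge:
  assumes "dc_decomposition D f g h" "y \<in> subdifferential D h xk" "x \<in> D"
  shows "f x \<le> dc_overestimation g h xk y x"
  using assms unfolding dc_decomposition_def subdifferential_def dc_overestimation_def by auto

lemma convex_on_dc_overestimation:
  assumes "dc_decomposition D f g h"
  shows "convex_on D (dc_overestimation g h xk y)"
proof -
  have g: "convex_on D g"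
    using assms by (simp add: dc_decomposition_def)
  have "convex_on D (\<lambda>x. - (h xk + (x - xk) \<bullet> y))"
    unfolding convex_on_def
  proof (intro conjI ballI allI impI)
    fix a b :: 'a and u v :: real
    assume "u + v = 1"
    then have v: "v = 1 - u"
      by simp
    show "- (h xk + (u *\<^sub>R a + v *\<^sub>R b - xk) \<bullet> y)
      \<le> u * - (h xk + (a - xk) \<bullet> y) + v * - (h xk + (b - xk) \<bullet> y)"
      unfolding v by (simp add: inner_diff_left inner_add_left algebra_simps)
  qed (use g in \<open>simp add: convex_on_imp_convex\<close>)
  from convex_on_add[OF g this] show ?thesis
    by (simp add: dc_overestimation_def[abs_def] algebra_simps)
qed

text \<open>
  The overestimation depends on the choice of subgradient, and so does any comparison of two
  overestimations: already for identical decompositions, two unrelated choices of subgradients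
  give overestimations of which neither need be below the other.
\<close>

lemma dc_overestimation_unrelated_subgradients:
  fixes h :: "real^'n \<Rightarrow> real"
  defines "h \<equiv> norm"
  shows "\<exists>y\<in>subdifferential UNIV h 0. \<exists>y'\<in>subdifferential UNIV h 0. \<exists>x.
    \<not> dc_overestimation h h 0 y x \<le> dc_overestimation h h 0 y' x"
proof -
  obtain i :: 'n where True by simp
  define e :: "real^'n" where "e = axis i 1"
  have n: "norm e = 1" by (simp add: e_def)
  have ee: "e \<bullet> e = 1" using n by (simp add: norm_eq_1)
  have le: "\<bar>z \<bullet> e\<bar> \<le> norm z" for z
    using Cauchy_Schwarz_ineq2[of z e] n by simp
  have 1: "e \<in> subdifferential UNIV h 0" "- e \<in> subdifferential UNIV h 0"
    using le by (auto simp: subdifferential_def h_def abs_le_iff)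
  have "\<not> dc_overestimation h h 0 e (- e) \<le> dc_overestimation h h 0 (- e) (- e)"
    using n ee by (simp add: dc_overestimation_def h_def)
  with 1 show ?thesis by blast
qed

end

theory Submission
  imports Defs
begin

text \<open>
  Put \<open>k = g' - g\<close>. On \<open>D\<close> the two decompositions give \<open>k = h' - h\<close>, and this is already (i).

  For (ii), the difference of the two overestimations at \<open>x\<close> is
  \<open>k x - (k xk + (x - xk) \<bullet> (y' - y))\<close>, so the overestimation of \<open>(g, h)\<close> lies below that of
  \<open>(g', h')\<close> on \<open>D\<close> if \<open>y' - y\<close> is a subgradient of \<open>k\<close> at \<open>xk\<close>. If \<open>g\<close> is less convex than
  \<open>g'\<close>, then \<open>h' = h + k\<close> with \<open>h\<close> and \<open>k\<close> convex, and the required subgradients come from the sum rule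
  \<open>\<partial>(h + k)(xk) = \<partial>h(xk) + \<partial>k(xk)\<close>. Its hard inclusion splits a given \<open>y'\<close> into \<open>y\<close> and a
  subgradient of \<open>k\<close>. It also shows that \<open>k\<close> has a subgradient as soon as \<open>h'\<close> has one, and
  adding that subgradient to a given \<open>y\<close> yields a suitable \<open>y'\<close> by the easy inclusion.

  The hard inclusion is a separation argument (\<open>convex_touching_separation\<close>). Since both summands are finite on the same set
  \<open>D\<close>, it holds at every point of \<open>D\<close>, also at relative boundary points, where a convex
  function need not have a subgradient.
\<close>

text \<open>
  The graphs of \<open>p\<close> and \<open>- q\<close> touch above \<open>x\<close>, and \<open>v\<close> is the negated slope of an affine function
  that separates them. The differences of points of the epigraph of \<open>p\<close> and points of the
  hypograph of \<open>- q\<close> form a convex set \<open>C\<close> that has the origin on its relative boundary. A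
  supporting hyperplane there that does not contain all of \<open>C\<close> cannot be vertical: the linear
  form of a vertical one would be nonnegative on the symmetric set \<open>D - D\<close>, hence vanish on \<open>C\<close>.
\<close>

lemma convex_touching_separation:
  fixes D :: "'a::euclidean_space set" and p q :: "'a \<Rightarrow> real"
  assumes p: "convex_on D p" and q: "convex_on D q"
    and nonneg: "\<And>z. z \<in> D \<Longrightarrow> 0 \<le> p z + q z"
    and x: "x \<in> D" "p x + q x = 0"
  obtains v where "\<And>z w. z \<in> D \<Longrightarrow> w \<in> D \<Longrightarrow> 0 \<le> (z - w) \<bullet> v + p z + q w"
proof -
  define C where "C = {(z - w, t) |z w t. z \<in> D \<and> w \<in> D \<and> p z + q w \<le> t}"
  have CI: "(z - w, t) \<in> C" if "z \<in> D" "w \<in> D" "p z + q w \<le> t" for z w t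
    using that by (auto simp: C_def)
  have "convex D"
    using p by (rule convex_on_imp_convex)
  have "convex C"
  proof (rule convexI)
    fix c c' and u v :: real
    assume cc: "c \<in> C" "c' \<in> C" and uv: "0 \<le> u" "0 \<le> v" "u + v = 1"
    obtain z w t where c: "c = (z - w, t)" "z \<in> D" "w \<in> D" "p z + q w \<le> t"
      using cc by (auto simp: C_def)
    obtain z' w' t' where c': "c' = (z' - w', t')" "z' \<in> D" "w' \<in> D" "p z' + q w' \<le> t'"
      using cc by (auto simp: C_def)
    have "p (u *\<^sub>R z + v *\<^sub>R z') \<le> u * p z + v * p z'"
      using p c c' uv by (simp add: convex_on_def)
    moreover have "q (u *\<^sub>R w + v *\<^sub>R w') \<le> u * q w + v * q w'"
      using q c c' uv by (simp add: convex_on_def)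
    moreover have "u * (p z + q w) \<le> u * t" "v * (p z' + q w') \<le> v * t'"
      using c c' uv by (simp_all add: mult_left_mono)
    ultimately have "p (u *\<^sub>R z + v *\<^sub>R z') + q (u *\<^sub>R w + v *\<^sub>R w') \<le> u * t + v * t'"
      by (simp add: distrib_left)
    then have "((u *\<^sub>R z + v *\<^sub>R z') - (u *\<^sub>R w + v *\<^sub>R w'), u * t + v * t') \<in> C"
      using \<open>convex D\<close> c c' uv by (intro CI convexD) auto
    then show "u *\<^sub>R c + v *\<^sub>R c' \<in> C"
      by (simp add: c(1) c'(1) algebra_simps)
  qed
  have zero: "0 \<in> C" and up: "(0, 1) \<in> C"
    using CI[of x x 0] CI[of x x 1] x by (simp_all add: zero_prod_def)
  have "0 \<notin> rel_interior C"
  proof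
    \<comment> \<open>Otherwise the segment from \<open>(0, 1)\<close> to the origin could be prolonged below the origin,
      where \<open>C\<close> has no points because \<open>p + q \<ge> 0\<close>.\<close>
    assume "0 \<in> rel_interior C"
    then obtain e where e: "e > 1" "(1 - e) *\<^sub>R (0, 1) + e *\<^sub>R 0 \<in> C"
      using convex_rel_interior_iff[OF \<open>convex C\<close>] zero up by blast
    then obtain z where "z \<in> D" "p z + q z \<le> 1 - e"
      by (auto simp: C_def)
    with nonneg[of z] e show False
      by simp
  qed
  then obtain a where "\<And>c. c \<in> C \<Longrightarrow> a \<bullet> 0 \<le> a \<bullet> c"
      "\<And>c. c \<in> rel_interior C \<Longrightarrow> a \<bullet> 0 < a \<bullet> c"
    using supporting_hyperplane_rel_boundary[OF \<open>convex C\<close> zero] by metis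
  then have a: "\<And>c. c \<in> C \<Longrightarrow> 0 \<le> a \<bullet> c" "\<And>c. c \<in> rel_interior C \<Longrightarrow> 0 < a \<bullet> c"
    by simp_all
  obtain u s where us: "a = (u, s)"
    by (cases a)
  have sep: "0 \<le> u \<bullet> (z - w) + s * t" if "z \<in> D" "w \<in> D" "p z + q w \<le> t" for z w t
    using a(1)[OF CI[OF that]] by (simp add: us)
  have "s \<noteq> 0"
  proof
    assume "s = 0"
    have "u \<bullet> (z - w) = 0" if "z \<in> D" "w \<in> D" for z w
      using sep[OF that order_refl] sep[OF that(2,1) order_refl] \<open>s = 0\<close>
      by (simp add: inner_diff_right)
    then have "a \<bullet> c = 0" if "c \<in> C" for c
      using that \<open>s = 0\<close> by (auto simp: C_def us)
    moreover obtain c where "c \<in> rel_interior C"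
      using rel_interior_eq_empty[OF \<open>convex C\<close>] zero by blast
    ultimately have "a \<bullet> c = 0" "0 < a \<bullet> c"
      using a(2) rel_interior_subset by blast+
    then show False
      by simp
  qed
  moreover have "0 \<le> s"
    using a(1)[OF up] by (simp add: us)
  ultimately have "0 < s"
    by simp
  show thesis
  proof
    fix z w
    assume "z \<in> D" "w \<in> D"
    then have "0 \<le> (u \<bullet> (z - w) + s * (p z + q w)) / s"
      using sep \<open>0 < s\<close> by simp
    also have "\<dots> = (u \<bullet> (z - w)) / s + (p z + q w)"
      using \<open>0 < s\<close> by (simp add: add_divide_distrib)
    also have "(u \<bullet> (z - w)) / s = (z - w) \<bullet> (u /\<^sub>R s)"
      by (simp only: inner_commute[of u] inner_scaleR_right divide_inverse_commute)
    finally show "0 \<le> (z - w) \<bullet> (u /\<^sub>R s) + p z + q w"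
      by (simp only: add.assoc)
  qed
qed

lemma subdifferential_addI:
  assumes "y \<in> subdifferential D h x" "w \<in> subdifferential D k x"
  shows "y + w \<in> subdifferential D (\<lambda>z. h z + k z) x"
  unfolding subdifferential_def
proof (intro CollectI conjI ballI)
  show "x \<in> D"
    using assms by (simp add: subdifferential_def)
  fix z
  assume "z \<in> D"
  then have "h x + (z - x) \<bullet> y \<le> h z" "k x + (z - x) \<bullet> w \<le> k z"
    using assms by (simp_all add: subdifferential_def)
  then show "h x + k x + (z - x) \<bullet> (y + w) \<le> h z + k z"
    by (simp add: inner_add_right)
qed

text \<open>
  The hard half of the Moreau--Rockafellar sum rule. Subtracting from \<open>h\<close> its value at \<open>x\<close> and the
  whole slope \<open>y'\<close>, and from \<open>k\<close> only its value at \<open>x\<close>, produces two functions with nonnegative sum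
  that vanishes at \<open>x\<close>. The vector that separates them is the part of \<open>y'\<close> that belongs to \<open>k\<close>.
\<close>

lemma subdifferential_addE:
  fixes D :: "'a::euclidean_space set"
  assumes h: "convex_on D h" and k: "convex_on D k"
    and y': "y' \<in> subdifferential D (\<lambda>z. h z + k z) x"
  obtains y w where "y \<in> subdifferential D h x" "w \<in> subdifferential D k x" "y' = y + w"
proof -
  have x: "x \<in> D" and ineq: "\<And>z. z \<in> D \<Longrightarrow> h x + k x + (z - x) \<bullet> y' \<le> h z + k z"
    using y' by (auto simp: subdifferential_def)
  \<comment> \<open>\<open>dc_overestimation h h x y'\<close> is \<open>h\<close> minus the affine function of slope \<open>y'\<close> through its value
    at \<open>x\<close>; it comes from the decomposition \<open>0 = h - h\<close>.\<close>
  have "convex_on D (dc_overestimation h h x y')"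
    using h by (intro convex_on_dc_overestimation[where f = "\<lambda>_. 0"])
      (simp add: dc_decomposition_def)
  moreover have "convex_on D (\<lambda>z. k z + - k x)"
    by (rule convex_on_add[OF k]) (simp add: convex_on_const convex_on_imp_convex[OF k])
  moreover have "0 \<le> dc_overestimation h h x y' z + (k z + - k x)" if "z \<in> D" for z
    using ineq[OF that] by (simp add: dc_overestimation_def)
  moreover have "dc_overestimation h h x y' x + (k x + - k x) = 0"
    by (simp add: dc_overestimation_def)
  ultimately obtain v where v: "\<And>z w. z \<in> D \<Longrightarrow> w \<in> D \<Longrightarrow>
      0 \<le> (z - w) \<bullet> v + dc_overestimation h h x y' z + (k w + - k x)"
    by (rule convex_touching_separation[OF _ _ _ x]) auto
  show thesis
  proof
    have "h x + (z - x) \<bullet> (y' - v) \<le> h z" if "z \<in> D" for z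
      using v[OF that x] by (simp add: dc_overestimation_def inner_diff_right)
    then show "y' - v \<in> subdifferential D h x"
      using x by (simp add: subdifferential_def)
    have "k x + (z - x) \<bullet> v \<le> k z" if "z \<in> D" for z
      using v[OF x that] by (simp add: dc_overestimation_def inner_diff_left)
    then show "v \<in> subdifferential D k x"
      using x by (simp add: subdifferential_def)
  qed simp
qed

lemma convex_on_cong:
  fixes p q :: "'a::real_vector \<Rightarrow> real"
  assumes "\<And>z. z \<in> D \<Longrightarrow> p z = q z"
  shows "convex_on D p \<longleftrightarrow> convex_on D q"
proof -
  have "convex_on D q" if "convex_on D p" and eq: "\<And>z. z \<in> D \<Longrightarrow> p z = q z" for p q :: "'a \<Rightarrow> real"
    unfolding convex_on_def
  proof (intro conjI ballI allI impI)
    show "convex D"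
      using that(1) by (rule convex_on_imp_convex)
    fix x y and u v :: real
    assume *: "x \<in> D" "y \<in> D" "0 \<le> u" "0 \<le> v" "u + v = 1"
    then have "u *\<^sub>R x + v *\<^sub>R y \<in> D"
      using \<open>convex D\<close> by (simp add: convexD)
    moreover have "p (u *\<^sub>R x + v *\<^sub>R y) \<le> u * p x + v * p y"
      using that(1) * by (simp add: convex_on_def)
    ultimately show "q (u *\<^sub>R x + v *\<^sub>R y) \<le> u * q x + v * q y"
      using eq * by simp
  qed
  from this[of p q] this[of q p] show ?thesis
    using assms by auto
qed

lemma dc_overestimation_le:
  assumes w: "w \<in> subdifferential D (\<lambda>z. h' z - h z) xk" and "x \<in> D"
    and dec: "dc_decomposition D f g h" "dc_decomposition D f g' h'"
  shows "dc_overestimation g h xk y x \<le> dc_overestimation g' h' xk (y + w) x"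
proof -
  have "h' xk - h xk + (x - xk) \<bullet> w \<le> h' x - h x"
    using w \<open>x \<in> D\<close> by (simp add: subdifferential_def)
  moreover have "g x - h x = g' x - h' x"
    using dec \<open>x \<in> D\<close> by (simp add: dc_decomposition_def)
  ultimately show ?thesis
    by (simp add: dc_overestimation_def inner_add_right)
qed

theorem proposition1:
  fixes D :: "(real^'n) set" and f g h g' h' :: "real^'n \<Rightarrow> real"
  assumes "D \<noteq> {}" and "closed D" and "convex D"
    and "dc_function D f"
    and "dc_decomposition D f g h"
    and "dc_decomposition D f g' h'"
  shows "(less_convex_on D g g' \<longleftrightarrow> less_convex_on D h h') \<and>
    (more_convex_on D g g' \<longleftrightarrow> more_convex_on D h h') \<and>
    (less_convex_on D g g' \<longrightarrow> (\<forall>xk\<in>D.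
      (\<forall>y'\<in>subdifferential D h' xk. \<exists>y\<in>subdifferential D h xk. \<forall>x\<in>D.
        dc_overestimation g h xk y x \<le> dc_overestimation g' h' xk y' x) \<and>
      (subdifferential D h' xk \<noteq> {} \<longrightarrow>
        (\<forall>y\<in>subdifferential D h xk. \<exists>y'\<in>subdifferential D h' xk. \<forall>x\<in>D.
          dc_overestimation g h xk y x \<le> dc_overestimation g' h' xk y' x))))"
proof -
  define k where "k = (\<lambda>z. h' z - h z)"
  note dec = assms(5,6)
  have eq: "g z - h z = g' z - h' z" if "z \<in> D" for z
    using dec that by (simp add: dc_decomposition_def)
  have less: "less_convex_on D g g' \<longleftrightarrow> less_convex_on D h h'"
    unfolding less_convex_on_def by (rule convex_on_cong) (use eq in force)+
  have more: "more_convex_on D g g' \<longleftrightarrow> more_convex_on D h h'"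
    unfolding more_convex_on_def by (rule convex_on_cong) (use eq in force)+
  have h: "convex_on D h"
    using dec by (simp add: dc_decomposition_def)
  have sub_h': "subdifferential D h' xk = subdifferential D (\<lambda>z. h z + k z) xk" for xk
    by (simp add: k_def)
  have le: "dc_overestimation g h xk y x \<le> dc_overestimation g' h' xk (y + w) x"
    if "w \<in> subdifferential D k xk" "x \<in> D" for xk x y w
    using dc_overestimation_le[OF _ _ dec] that by (simp add: k_def)
  have split: "\<exists>y\<in>subdifferential D h xk. \<exists>w\<in>subdifferential D k xk. y' = y + w"
    if "less_convex_on D g g'" "y' \<in> subdifferential D h' xk" for xk y'
  proof -
    have "convex_on D k"
      using that(1) less by (simp add: less_convex_on_def k_def)
    then show ?thesis
      using that(2) unfolding sub_h' by (blast elim: subdifferential_addE[OF h])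
  qed
  have "\<exists>y\<in>subdifferential D h xk. \<forall>x\<in>D.
      dc_overestimation g h xk y x \<le> dc_overestimation g' h' xk y' x"
    if "less_convex_on D g g'" "y' \<in> subdifferential D h' xk" for xk y'
    using split[OF that] le by blast
  moreover have "\<exists>y'\<in>subdifferential D h' xk. \<forall>x\<in>D.
      dc_overestimation g h xk y x \<le> dc_overestimation g' h' xk y' x"
    if lc: "less_convex_on D g g'" and ne: "subdifferential D h' xk \<noteq> {}"
      and y: "y \<in> subdifferential D h xk" for xk y
  proof -
    obtain w where w: "w \<in> subdifferential D k xk"
      using split[OF lc] ne by blast
    show ?thesis
      using subdifferential_addI[OF y w] le[OF w] unfolding sub_h' by blast
  qed
  ultimately show ?thesis
    using less more by blast
qed

end
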